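(* Let $w\in\mathbb{R}^p$ and $\rho>0$. Assume $g_f(w)\neq 0$, $g_r(w)\neq 0$, $q(w)\neq 0$, and that there is $M_r>0$ such that $\|\nabla^2L_r(z)\|_{\mathrm{op}}\le M_r$ for all $z\in\Gamma(w)$, where $$\Gamma(w)=\{w+t\,\delta_{\mathrm{std}}(w):t\in[0,1]\}\cup\{w+t\,\delta_{\mathrm{rosu}}(w):t\in[0,1]\}.$$ Then: (i) $g_r(w)^\top\delta_{\mathrm{rosu}}(w)=0$, and $$L_r\bigl(w+\delta_{\mathrm{rosu}}(w)\bigr)\le L_r(w)+\frac{M_r}{2}\rho^2.$$ (ii) $$L_r\bigl(w+\delta_{\mathrm{std}}(w)\bigr)-L_r\bigl(w+\delta_{\mathrm{rosu}}(w)\bigr)\ge \rho\,\|g_r(w)\|_2\cos\theta(w)-M_r\rho^2.$$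
   Context: $L_f,L_r:\mathbb{R}^p\to\mathbb{R}$ are differentiable functions (forget and retain losses), with gradients $g_f(w)=\nabla L_f(w)$ and $g_r(w)=\nabla L_r(w)$; $L_r$ is twice differentiable at the points where its Hessian $\nabla^2 L_r$ is used. For nonzero $g_f(w),g_r(w)$, the angle $\theta(w)\in[0,\pi]$ is defined by $\cos\theta(w)=\dfrac{g_f(w)^\top g_r(w)}{\|g_f(w)\|_2\|g_r(w)\|_2}$. Put $P_r(w)=\dfrac{g_r(w)g_r(w)^\top}{\|g_r(w)\|_2^2}$, $q(w)=(I-P_r(w))g_f(w)$, and $$\delta_{\mathrm{std}}(w)=\rho\,\frac{g_f(w)}{\|g_f(w)\|_2},\qquad \delta_{\mathrm{rosu}}(w)=\rho\,\frac{q(w)}{\|q(w)\|_2}.$$ *)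

theory Defs
  imports "HOL-Analysis.Analysis"
begin

definition grad :: "(real ^ 'p \<Rightarrow> real) \<Rightarrow> real ^ 'p \<Rightarrow> real ^ 'p" where
  "grad L w = (THE D. GDERIV L w :> D)"

lemma GDERIV_grad:
  fixes L :: "real ^ 'p \<Rightarrow> real"
  assumes "L differentiable (at w)"
  shows "GDERIV L w :> grad L w"
proof -
  obtain f' where f': "(L has_derivative f') (at w)"
    using assms by (auto simp: differentiable_def)
  define D where "D = adjoint f' 1"
  have "linear f'"
    using f' by (rule has_derivative_linear)
  then have "h \<bullet> D = f' h" for h
    unfolding D_def by (simp add: adjoint_works)
  then have "f' = (\<lambda>h. h \<bullet> D)"
    by presburger
  then have "GDERIV L w :> D"
    using f' unfolding gderiv_def by simp
  moreover have "D' = D" if "GDERIV L w :> D'" for D'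
  proof -
    have "(\<lambda>h. h \<bullet> D') = (\<lambda>h. h \<bullet> D)"
      by (rule has_derivative_unique[OF that[unfolded gderiv_def] \<open>GDERIV L w :> D\<close>[unfolded gderiv_def]])
    then have "\<forall>h. h \<bullet> D' = h \<bullet> D"
      by (intro allI) (drule fun_cong, assumption)
    then show ?thesis
      by (simp only: vector_eq_ldot)
  qed
  ultimately show ?thesis
    unfolding grad_def by (rule theI)
qed

text \<open>The Hessian matrix at \<open>z\<close> is the Jacobian of the gradient; it is meaningful only where
  \<open>grad L\<close> is differentiable, so statements using it must assume this.\<close>

definition hessian :: "(real ^ 'p \<Rightarrow> real) \<Rightarrow> real ^ 'p \<Rightarrow> real ^ 'p ^ 'p" where
  "hessian L z = matrix (frechet_derivative (grad L) (at z))"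

definition op_norm :: "real ^ 'p ^ 'p \<Rightarrow> real" where
  "op_norm A = onorm (\<lambda>x. A *v x)"

definition outer :: "real ^ 'p \<Rightarrow> real ^ 'p \<Rightarrow> real ^ 'p ^ 'p" where
  "outer u v = (\<chi> i j. u $ i * v $ j)"

text \<open>Below, \<open>Lf\<close> is the forget loss and \<open>Lr\<close> the retain loss.\<close>

definition grad_angle :: "(real ^ 'p \<Rightarrow> real) \<Rightarrow> (real ^ 'p \<Rightarrow> real) \<Rightarrow> real ^ 'p \<Rightarrow> real" where
  "grad_angle Lf Lr w = arccos ((grad Lf w \<bullet> grad Lr w) / (norm (grad Lf w) * norm (grad Lr w)))"

definition retain_proj :: "(real ^ 'p \<Rightarrow> real) \<Rightarrow> real ^ 'p \<Rightarrow> real ^ 'p ^ 'p" where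
  "retain_proj Lr w = (1 / (norm (grad Lr w))\<^sup>2) *\<^sub>R outer (grad Lr w) (grad Lr w)"

definition q_dir :: "(real ^ 'p \<Rightarrow> real) \<Rightarrow> (real ^ 'p \<Rightarrow> real) \<Rightarrow> real ^ 'p \<Rightarrow> real ^ 'p" where
  "q_dir Lf Lr w = (mat 1 - retain_proj Lr w) *v grad Lf w"

definition delta_std :: "(real ^ 'p \<Rightarrow> real) \<Rightarrow> real \<Rightarrow> real ^ 'p \<Rightarrow> real ^ 'p" where
  "delta_std Lf \<rho> w = (\<rho> / norm (grad Lf w)) *\<^sub>R grad Lf w"

definition delta_rosu ::
  "(real ^ 'p \<Rightarrow> real) \<Rightarrow> (real ^ 'p \<Rightarrow> real) \<Rightarrow> real \<Rightarrow> real ^ 'p \<Rightarrow> real ^ 'p" where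
  "delta_rosu Lf Lr \<rho> w = (\<rho> / norm (q_dir Lf Lr w)) *\<^sub>R q_dir Lf Lr w"

definition segments ::
  "(real ^ 'p \<Rightarrow> real) \<Rightarrow> (real ^ 'p \<Rightarrow> real) \<Rightarrow> real \<Rightarrow> real ^ 'p \<Rightarrow> (real ^ 'p) set" where
  "segments Lf Lr \<rho> w =
     {w + t *\<^sub>R delta_std Lf \<rho> w | t. t \<in> {0..1}} \<union>
     {w + t *\<^sub>R delta_rosu Lf Lr \<rho> w | t. t \<in> {0..1}}"

end

theory Submission
  imports Defs
begin

text \<open>Restricted to the segment from \<open>w\<close> to \<open>w + d\<close>, the loss is a function of one variable with
  second derivative \<open>d \<bullet> H d\<close>, so Taylor's theorem with Lagrange remainder gives the two-sided
  estimate \<open>\<bar>L (w + d) - L w - grad L w \<bullet> d\<bar> \<le> M / 2 * (norm d)\<^sup>2\<close>. Both perturbations have norm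
  \<open>\<rho>\<close>; the first-order term vanishes for the projected one, which is orthogonal to \<open>grad Lr w\<close>,
  and equals \<open>\<rho> * norm (grad Lr w) * cos \<theta>\<close> for the standard one.\<close>

lemma hessian_mult:
  fixes L :: "real ^ 'p \<Rightarrow> real"
  assumes "grad L differentiable (at z)"
  shows "hessian L z *v x = frechet_derivative (grad L) (at z) x"
  unfolding hessian_def
  using assms by (simp add: matrix_works linear_frechet_derivative linear_linear)

text \<open>Cauchy-Schwarz reduces the quadratic form to \<open>norm x * norm (H x)\<close> with
  \<open>H\<close> the Hessian, and the operator norm bounds the second factor.\<close>

lemma inner_hessian_le:
  fixes L :: "real ^ 'p \<Rightarrow> real"
  assumes "op_norm (hessian L z) \<le> M"
  shows "\<bar>x \<bullet> (hessian L z *v x)\<bar> \<le> M * (norm x)\<^sup>2"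
proof -
  have "norm (hessian L z *v x) \<le> op_norm (hessian L z) * norm x"
    unfolding op_norm_def by (intro onorm matrix_vector_mul_bounded_linear)
  also have "\<dots> \<le> M * norm x"
    using assms by (intro mult_right_mono) auto
  finally have "norm x * norm (hessian L z *v x) \<le> norm x * (M * norm x)"
    by (intro mult_left_mono) auto
  moreover have "\<bar>x \<bullet> (hessian L z *v x)\<bar> \<le> norm x * norm (hessian L z *v x)"
    by (rule Cauchy_Schwarz_ineq2)
  ultimately show ?thesis
    by (simp add: power2_eq_square algebra_simps)
qed

lemma taylor_second_order_bound:
  fixes L :: "real ^ 'p \<Rightarrow> real"
  assumes L: "\<And>x. L differentiable (at x)"
    and G: "\<And>t. t \<in> {0..1} \<Longrightarrow> grad L differentiable (at (w + t *\<^sub>R d))"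
    and H: "\<And>t. t \<in> {0..1} \<Longrightarrow> op_norm (hessian L (w + t *\<^sub>R d)) \<le> M"
  shows "\<bar>L (w + d) - L w - grad L w \<bullet> d\<bar> \<le> M / 2 * (norm d)\<^sup>2"
proof -
  define z where "z t = w + t *\<^sub>R d" for t :: real
  \<comment> \<open>For \<open>m \<le> 2\<close>, \<open>diff m\<close> is the \<open>m\<close>-th
    derivative of \<open>L\<close> along the segment, in the form \<open>Maclaurin\<close> expects.
    An expansion of order 2 reads no higher index, so the last branch may serve as the
    default.\<close>
  define diff :: "nat \<Rightarrow> real \<Rightarrow> real" where
    "diff m t = (if m = 0 then L (z t) else if m = 1 then d \<bullet> grad L (z t)
                 else d \<bullet> (hessian L (z t) *v d))" for m t
  have z: "(z has_derivative (\<lambda>h. h *\<^sub>R d)) (at t)" for t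
    unfolding z_def by (auto intro!: derivative_eq_intros)
  have first: "((\<lambda>t. L (z t)) has_real_derivative d \<bullet> grad L (z t)) (at t)" for t
  proof -
    have "(L has_derivative (\<lambda>h. h \<bullet> grad L (z t))) (at (z t))"
      using GDERIV_grad[OF L] by (simp add: gderiv_def)
    from has_derivative_compose[OF z this] show ?thesis
      by (simp add: has_field_derivative_def mult.commute[of _ "d \<bullet> _"])
  qed
  have second: "((\<lambda>t. d \<bullet> grad L (z t)) has_real_derivative d \<bullet> (hessian L (z t) *v d)) (at t)"
    if "t \<in> {0..1}" for t
  proof -
    have G': "grad L differentiable (at (z t))"
      using G[OF that] by (simp add: z_def)
    then have "(grad L has_derivative (\<lambda>h. hessian L (z t) *v h)) (at (z t))"
      by (simp add: hessian_mult flip: frechet_derivative_works)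
    from has_derivative_inner_right[OF has_derivative_compose[OF z this], of d] show ?thesis
      by (simp add: has_field_derivative_def matrix_vector_mult_scaleR mult.commute[of _ "d \<bullet> _"])
  qed
  \<comment> \<open>The Lagrange remainder asks only that the second derivative exist at each point
    of the segment, which is what \<open>second\<close> supplies.\<close>
  have "\<exists>t>0. t < 1 \<and>
      L (z 1) = (\<Sum>m<2. diff m 0 / fact m * 1 ^ m) + diff 2 t / fact 2 * 1 ^ 2"
  proof (rule Maclaurin)
    show "\<forall>m t. m < 2 \<and> 0 \<le> t \<and> t \<le> 1 \<longrightarrow> DERIV (diff m) t :> diff (Suc m) t"
      using first second by (auto simp: diff_def[abs_def] less_2_cases_iff)
  qed (auto simp: diff_def)
  then obtain t where t: "0 < t" "t < 1"
    and eq: "L (z 1) = L (z 0) + d \<bullet> grad L (z 0) + d \<bullet> (hessian L (z t) *v d) / 2"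
    by (auto simp: diff_def numeral_2_eq_2)
  have "\<bar>d \<bullet> (hessian L (z t) *v d)\<bar> \<le> M * (norm d)\<^sup>2"
    using t H[of t] by (intro inner_hessian_le) (simp add: z_def)
  then show ?thesis
    using eq by (simp add: z_def inner_commute abs_le_iff)
qed

lemma outer_mult_vector: "outer u v *v x = (v \<bullet> x) *\<^sub>R u"
  by (simp add: outer_def matrix_vector_mult_def inner_vec_def vec_eq_iff
      sum_distrib_left mult_ac)

text \<open>\<open>retain_proj\<close> is the orthogonal projection onto the line spanned by
  \<open>grad Lr w\<close>, so \<open>q_dir\<close> is the component of \<open>grad Lf w\<close>
  orthogonal to that line.\<close>

lemma inner_q_dir:
  assumes "grad Lr w \<noteq> 0"
  shows "grad Lr w \<bullet> q_dir Lf Lr w = 0"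
  using assms
  by (simp add: q_dir_def retain_proj_def matrix_vector_mult_diff_rdistrib
      scaleR_matrix_vector_assoc[symmetric] outer_mult_vector inner_diff_right
      power2_norm_eq_inner)

text \<open>By Cauchy-Schwarz the quotient lies in \<open>[-1, 1]\<close>, where \<open>cos\<close>
  inverts \<open>arccos\<close>. If a gradient vanishes, the quotient is 0 by the convention for
  division by zero.\<close>

lemma cos_grad_angle:
  "cos (grad_angle Lf Lr w)
    = (grad Lf w \<bullet> grad Lr w) / (norm (grad Lf w) * norm (grad Lr w))"
proof -
  have "\<bar>(grad Lf w \<bullet> grad Lr w) / (norm (grad Lf w) * norm (grad Lr w))\<bar> \<le> 1"
    using Cauchy_Schwarz_ineq2[of "grad Lf w" "grad Lr w"]
    by (auto simp: abs_mult divide_le_eq_1)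
  then show ?thesis
    unfolding grad_angle_def by (intro cos_arccos_abs)
qed

theorem theorem1:
  fixes Lf Lr :: "real ^ 'p \<Rightarrow> real"
    and w :: "real ^ 'p"
    and \<rho> M :: real
  assumes "\<forall>x. Lf differentiable (at x)"
    and "\<forall>x. Lr differentiable (at x)"
    and "\<rho> > 0"
    and "grad Lf w \<noteq> 0"
    and "grad Lr w \<noteq> 0"
    and "q_dir Lf Lr w \<noteq> 0"
    and "M > 0"
    and "\<forall>z \<in> segments Lf Lr \<rho> w. grad Lr differentiable (at z)"
    and "\<forall>z \<in> segments Lf Lr \<rho> w. op_norm (hessian Lr z) \<le> M"
  shows "(grad Lr w \<bullet> delta_rosu Lf Lr \<rho> w = 0 \<and>
          Lr (w + delta_rosu Lf Lr \<rho> w) \<le> Lr w + M / 2 * \<rho>\<^sup>2) \<and>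
         Lr (w + delta_std Lf \<rho> w) - Lr (w + delta_rosu Lf Lr \<rho> w)
           \<ge> \<rho> * norm (grad Lr w) * cos (grad_angle Lf Lr w) - M * \<rho>\<^sup>2"
proof -
  let ?s = "delta_std Lf \<rho> w" and ?r = "delta_rosu Lf Lr \<rho> w"
  have taylor: "\<bar>Lr (w + d) - Lr w - grad Lr w \<bullet> d\<bar> \<le> M / 2 * (norm d)\<^sup>2"
    if "d = ?s \<or> d = ?r" for d
    using assms that by (intro taylor_second_order_bound) (auto simp: segments_def)
  have norms: "norm ?s = \<rho>" "norm ?r = \<rho>"
    using assms by (auto simp: delta_std_def delta_rosu_def)
  have orth: "grad Lr w \<bullet> ?r = 0"
    using assms by (simp add: delta_rosu_def inner_q_dir)
  have std: "grad Lr w \<bullet> ?s = \<rho> * norm (grad Lr w) * cos (grad_angle Lf Lr w)"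
    using assms by (simp add: delta_std_def cos_grad_angle inner_commute)
  have "\<bar>Lr (w + ?s) - Lr w - \<rho> * norm (grad Lr w) * cos (grad_angle Lf Lr w)\<bar> \<le> M / 2 * \<rho>\<^sup>2"
    "\<bar>Lr (w + ?r) - Lr w\<bar> \<le> M / 2 * \<rho>\<^sup>2"
    using taylor[of ?s] taylor[of ?r] unfolding norms orth std by simp_all
  \<comment> \<open>The lower bound at \<open>?s\<close> and the upper bound at \<open>?r\<close>
    each cost one such error term; subtracting them cancels \<open>Lr w\<close> and adds the
    errors.\<close>
  moreover have "M / 2 * \<rho>\<^sup>2 + M / 2 * \<rho>\<^sup>2 = M * \<rho>\<^sup>2"
    by (simp add: field_simps)
  ultimately show ?thesis
    using orth by (intro conjI) linarith+
qed

end
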